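(* Let $ABC$ be a triangle inscribed in the unit sphere. Then there is an isosceles triangle $A'B'C'$ inscribed in the unit sphere with the following properties: (i) the greatest central angles of the two triangles are equal to each other, and the spherical areas of the two triangles are equal to each other; (ii) the volume of the facial tetrahedron with base $A'B'C'$ is greater than or equal to the volume of the facial tetrahedron with base $ABC$.
   Context: The unit sphere is the sphere of radius 1 in $\mathbb{R}^3$ centred at $O$. Three points $A,B,C$ on the unit sphere determine both a spherical triangle and a rectilinear (Euclidean) triangle, both denoted $ABC$; "a triangle inscribed in the unit sphere" means such a triple. The spherical area of $ABC$ is the area of the spherical triangle $ABC$, i.e. of the central projection from $O$ of the rectilinear triangle $ABC$ onto the unit sphere. The central angles of the edges $BC$, $AC$, $AB$ are the angles $\alpha_A,\alpha_B,\alpha_C$ of the rectilinear triangle $ABC$ at $A$, $B$, $C$, respectively. The facial tetrahedron with base $ABC$ is the Euclidean tetrahedron $ABCO$ with base the rectilinear triangle $ABC$ and apex $O$. *)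

theory Defs
  imports "HOL-Analysis.Analysis"
begin

definition inscribed_triangle :: "real^3 \<Rightarrow> real^3 \<Rightarrow> real^3 \<Rightarrow> bool" where
  "inscribed_triangle A B C \<longleftrightarrow> {A, B, C} \<subseteq> sphere 0 1 \<and> \<not> collinear {A, B, C}"

definition isosceles :: "real^3 \<Rightarrow> real^3 \<Rightarrow> real^3 \<Rightarrow> bool" where
  "isosceles A B C \<longleftrightarrow> dist A B = dist A C \<or> dist B A = dist B C \<or> dist C A = dist C B"

text \<open>The angle at the middle argument \<open>Q\<close>, in \<open>[0, pi]\<close>; meaningful only for \<open>P \<noteq> Q \<noteq> R\<close>.\<close>

definition angle_at :: "real^3 \<Rightarrow> real^3 \<Rightarrow> real^3 \<Rightarrow> real" where
  "angle_at P Q R = arccos (((P - Q) \<bullet> (R - Q)) / (norm (P - Q) * norm (R - Q)))"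

text \<open>The central angle of an edge is, by convention, the angle of the rectilinear triangle
  at the vertex opposite to that edge (not the angle under which the edge is seen from the
  centre of the sphere). The three entries belong to the edges \<open>BC\<close>, \<open>AC\<close>, \<open>AB\<close>.\<close>

definition greatest_central_angle :: "real^3 \<Rightarrow> real^3 \<Rightarrow> real^3 \<Rightarrow> real" where
  "greatest_central_angle A B C = Max {angle_at B A C, angle_at A B C, angle_at A C B}"

text \<open>Surface area on the unit sphere, normalised as in integration in polar coordinates:
  \<open>S\<close> gets three times the Lebesgue measure of the cone over \<open>S\<close> with apex at the centre.\<close>

definition sphere_area :: "(real^3) set \<Rightarrow> real" where
  "sphere_area S = 3 * measure lebesgue {t *\<^sub>R x |t x. 0 \<le> t \<and> t \<le> 1 \<and> x \<in> S}"

lemma sphere_area_sphere: "sphere_area (sphere 0 1) = 4 * pi"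
proof -
  have "{t *\<^sub>R x |t x. 0 \<le> t \<and> t \<le> 1 \<and> x \<in> sphere 0 1} = cball (0 :: real^3) 1"
  proof (intro set_eqI iffI)
    fix y :: "real^3"
    assume y: "y \<in> cball 0 1"
    show "y \<in> {t *\<^sub>R x |t x. 0 \<le> t \<and> t \<le> 1 \<and> x \<in> sphere 0 1}"
    proof (cases "y = 0")
      case True
      have "y = 0 *\<^sub>R axis 1 1 \<and> (0::real) \<le> 0 \<and> (0::real) \<le> 1 \<and> axis 1 1 \<in> sphere (0 :: real^3) 1"
        using True by simp
      then show ?thesis by blast
    next
      case False
      then have "y = norm y *\<^sub>R sgn y \<and> 0 \<le> norm y \<and> norm y \<le> 1 \<and> sgn y \<in> sphere 0 1"
        using y by (simp add: sgn_div_norm)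
      then show ?thesis by blast
    qed
  qed auto
  then show ?thesis
    by (simp add: sphere_area_def content_cball unit_ball_vol_3)
qed

text \<open>The central projection of the rectilinear triangle; \<open>sgn x\<close> is \<open>x / norm x\<close>. The centre,
  which has no projection, lies in the triangle only if it is coplanar with \<open>A\<close>, \<open>B\<close>, \<open>C\<close>.\<close>

definition spherical_triangle :: "real^3 \<Rightarrow> real^3 \<Rightarrow> real^3 \<Rightarrow> (real^3) set" where
  "spherical_triangle A B C = sgn ` (convex hull {A, B, C} - {0})"

definition spherical_area :: "real^3 \<Rightarrow> real^3 \<Rightarrow> real^3 \<Rightarrow> real" where
  "spherical_area A B C = sphere_area (spherical_triangle A B C)"

definition facial_tetrahedron :: "real^3 \<Rightarrow> real^3 \<Rightarrow> real^3 \<Rightarrow> (real^3) set" where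
  "facial_tetrahedron A B C = convex hull {A, B, C, 0}"

end

theory Submission
  imports Defs "HOL-Real_Asymp.Real_Asymp"
begin

text \<open>
Write \<open>D\<close> for the absolute value of the triple product of \<open>A\<close>, \<open>B\<close>, \<open>C\<close>, and
\<open>w = 1 + A \<bullet> B + B \<bullet> C + C \<bullet> A\<close>. The volume of the facial tetrahedron is proportional to \<open>D\<close>
(\<open>measure_facial_tetrahedron\<close>), and the spherical area is twice the argument of \<open>w + \<i> D\<close>
(\<open>spherical_area_eq_Arg\<close>). So two triangles have equal areas if their pairs \<open>(D, w)\<close> are positively
proportional, and then the one with the larger \<open>D\<close> has the larger volume.

The area formula is derived from the definition by Lebesgue measure. The cone over a spherical
triangle is an intersection of three half-balls, and inclusion and exclusion express its volume by
those of the three pairwise wedges (\<open>measure_three_half_balls\<close>). A wedge has volume proportional to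
its angle (\<open>measure_wedge\<close>). This is Girard's formula (\<open>girard_formula\<close>): the area is the angle sum
minus \<open>pi\<close>. Multiplying the exponentials of the three angles gives the square of \<open>w + \<i> D\<close>, up to
a positive factor.

Now let the greatest angle be the one at \<open>C\<close>, with cosine \<open>c\<close> and sine \<open>s\<close>, let \<open>q\<close> be the product
of the sides meeting in \<open>C\<close>, and \<open>x\<close> the square of the circumradius. Then
\<open>D = q * s * sqrt (1 - x)\<close> and \<open>w = 4 - 4 * x * s\<^sup>2 - c * q\<close>
(\<open>inscribed_triangle_parameters\<close>). For given \<open>c\<close> and \<open>x\<close>, the largest possible \<open>q\<close> is
\<open>2 * x * (1 + c)\<close>, attained by the isosceles triangle with apex \<open>C\<close>. Enlarging \<open>q\<close> to this
value does not decrease the area, and shrinking the circumradius to \<open>0\<close> makes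
the area vanish. In between there is an isosceles triangle with the original area, and it can be
chosen with at least the original \<open>D\<close> (\<open>isosceles_parameter_exists\<close>). Its apex angle is still its
greatest angle, because the greatest angle of a triangle is at least \<open>pi / 3\<close>.
\<close>

section \<open>Volumes of wedges of the unit ball\<close>

definition half_ball :: "'a::euclidean_space \<Rightarrow> 'a set" where
  "half_ball n = {x \<in> cball 0 1. 0 \<le> n \<bullet> x}"

text \<open>The reflection in the hyperplane orthogonal to \<open>a - b\<close>; it fixes every vector that cannot tell
\<open>a\<close> and \<open>b\<close> apart.\<close>

lemma unit_vectors_swapped_by_reflection:
  fixes a b :: "'a::real_inner"
  assumes "norm a = norm b"
  obtains f where "orthogonal_transformation f" "f a = b" "\<And>x. a \<bullet> x = b \<bullet> x \<Longrightarrow> f x = x"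
proof -
  define v where "v = a - b"
  define f where "f x = x - (2 * (v \<bullet> x) / (v \<bullet> v)) *\<^sub>R v" for x
  have "linear f"
    unfolding f_def
    by (rule linearI) (simp_all add: inner_add_right add_divide_distrib algebra_simps)
  moreover have "f x \<bullet> f y = x \<bullet> y" for x y
  proof (cases "v = 0")
    case False
    then show ?thesis
      by (simp add: f_def inner_diff_left inner_diff_right inner_commute field_simps)
  qed (simp add: f_def)
  ultimately have "orthogonal_transformation f"
    by (simp add: orthogonal_transformation_def)
  moreover have "f a = b"
  proof (cases "v = 0")
    case False
    have "a \<bullet> a = b \<bullet> b"
      using assms by (simp add: dot_square_norm)
    then have "2 * (v \<bullet> a) = v \<bullet> v"
      by (simp add: v_def inner_diff_left inner_diff_right inner_commute)
    with False show ?thesis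
      by (simp add: f_def) (simp add: v_def)
  qed (simp add: f_def v_def)
  moreover have "f x = x" if "a \<bullet> x = b \<bullet> x" for x
    using that by (simp add: f_def v_def inner_diff_left)
  ultimately show ?thesis
    using that by blast
qed

text \<open>Two reflections suffice. The first carries \<open>a\<close> to \<open>c\<close>; the second carries the image of \<open>b\<close> to
\<open>d\<close> and leaves \<open>c\<close> alone, because \<open>c\<close> has the same inner product with both of them.\<close>

lemma orthogonal_transformation_between_unit_pairs:
  fixes a b c d :: "'a::real_inner"
  assumes n: "norm a = 1" "norm b = 1" "norm c = 1" "norm d = 1" and eq: "a \<bullet> b = c \<bullet> d"
  obtains f where "orthogonal_transformation f" "f a = c" "f b = d"
proof -
  obtain g where g: "orthogonal_transformation g" "g a = c"
    using unit_vectors_swapped_by_reflection[of a c] n by metis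
  have "norm (g b) = norm d"
    using g n by (simp add: orthogonal_transformation_norm)
  then obtain h where h: "orthogonal_transformation h" "h (g b) = d"
      and fixd: "\<And>x. g b \<bullet> x = d \<bullet> x \<Longrightarrow> h x = x"
    using unit_vectors_swapped_by_reflection[of "g b" d] by metis
  have "g b \<bullet> g a = b \<bullet> a"
    using g(1) by (simp add: orthogonal_transformation_def)
  then have "g b \<bullet> g a = d \<bullet> g a"
    using g eq by (simp add: inner_commute)
  then have "h (g a) = c"
    using fixd g by simp
  then show ?thesis
    using that[of "h \<circ> g"] g h by (simp add: orthogonal_transformation_compose)
qed

lemma half_ball_subset_cball: "half_ball n \<subseteq> cball 0 1"
  by (auto simp: half_ball_def)

lemma half_ball_lmeasurable [simp]: "half_ball n \<in> lmeasurable"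
proof -
  have "half_ball n = cball 0 1 \<inter> {x. 0 \<le> n \<bullet> x}"
    by (auto simp: half_ball_def)
  then show ?thesis
    using closed_halfspace_ge[of 0 n] by (simp add: compact_Int_closed lmeasurable_compact inner_commute)
qed

lemma half_ball_orthogonal_image:
  fixes f :: "'a::euclidean_space \<Rightarrow> 'a"
  assumes f: "orthogonal_transformation f"
  shows "f ` half_ball n = half_ball (f n)"
proof -
  have "surj f"
    using f by (rule orthogonal_transformation_surj)
  have iff: "f x \<in> half_ball (f n) \<longleftrightarrow> x \<in> half_ball n" for x
    using f by (simp add: half_ball_def orthogonal_transformation_norm) (simp add: orthogonal_transformation_def)
  show ?thesis
  proof
    show "half_ball (f n) \<subseteq> f ` half_ball n"
    proof
      fix y assume "y \<in> half_ball (f n)"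
      moreover obtain x where "y = f x"
        using surjD[OF \<open>surj f\<close>] by blast
      ultimately show "y \<in> f ` half_ball n"
        using iff by blast
    qed
  qed (use iff in blast)
qed

lemma measure_wedge_cong:
  fixes a b c d :: "real^'n::{finite,wellorder}"
  assumes "norm a = 1" "norm b = 1" "norm c = 1" "norm d = 1" and "a \<bullet> b = c \<bullet> d"
  shows "measure lebesgue (half_ball a \<inter> half_ball b) = measure lebesgue (half_ball c \<inter> half_ball d)"
proof -
  obtain f where f: "orthogonal_transformation f" "f a = c" "f b = d"
    using orthogonal_transformation_between_unit_pairs assms by metis
  have "f ` (half_ball a \<inter> half_ball b) = half_ball c \<inter> half_ball d"
    using f by (simp add: image_Int orthogonal_transformation_inj half_ball_orthogonal_image)
  then show ?thesis
    using measure_orthogonal_image[OF f(1)] by (metis fmeasurable.Int half_ball_lmeasurable)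
qed

lemma orthogonal_transformation_uminus: "orthogonal_transformation (uminus :: 'a::euclidean_space \<Rightarrow> 'a)"
  by (simp add: orthogonal_transformation_def linear_uminus)

lemma half_ball_uminus: "half_ball (- n) = uminus ` half_ball n"
  by (simp add: half_ball_orthogonal_image orthogonal_transformation_uminus)

lemma negligible_half_balls_opposite:
  assumes "n \<noteq> 0"
  shows "negligible (half_ball n \<inter> half_ball (- n))"
  by (rule negligible_subset[OF negligible_hyperplane[of n 0]]) (use assms in \<open>auto simp: half_ball_def\<close>)

lemma measure_half_ball_split:
  fixes n :: "real^'n::{finite,wellorder}"
  assumes "n \<noteq> 0" and "S \<in> lmeasurable" "S \<subseteq> cball 0 1"
  shows "measure lebesgue S = measure lebesgue (S \<inter> half_ball n) + measure lebesgue (S \<inter> half_ball (- n))"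
proof -
  have S: "S = (S \<inter> half_ball n) \<union> (S \<inter> half_ball (- n))"
    using assms(3) by (auto simp: half_ball_def)
  have "negligible ((S \<inter> half_ball n) \<inter> (S \<inter> half_ball (- n)))"
    by (rule negligible_subset[OF negligible_half_balls_opposite[OF assms(1)]]) auto
  then have "measure lebesgue ((S \<inter> half_ball n) \<inter> (S \<inter> half_ball (- n))) = 0"
    by (simp add: negligible_imp_measure0)
  then show ?thesis
    using S measure_Un3[of "S \<inter> half_ball n" lebesgue "S \<inter> half_ball (- n)"] assms(2)
    by (metis add.right_neutral diff_zero fmeasurable.Int half_ball_lmeasurable)
qed

lemma measure_half_ball:
  fixes n :: "real^'n::{finite,wellorder}"
  assumes "n \<noteq> 0"
  shows "measure lebesgue (half_ball n) = measure lebesgue (cball (0::real^'n::{finite,wellorder}) 1) / 2"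
proof -
  have "measure lebesgue (half_ball (- n)) = measure lebesgue (half_ball n)"
    unfolding half_ball_uminus by (intro measure_orthogonal_image orthogonal_transformation_uminus) simp
  moreover have "cball 0 1 \<inter> half_ball m = half_ball m" for m :: "real^'n::{finite,wellorder}"
    by (auto simp: half_ball_def)
  ultimately show ?thesis
    using measure_half_ball_split[OF assms, of "cball 0 1"] by simp
qed

text \<open>Inclusion and exclusion for the three half-balls, whose union misses a set congruent to their
intersection by central symmetry. Because the unknown triple intersection thus occurs twice, its
volume can be expressed by volumes of pairwise intersections. This is Girard's argument; applied
to coplanar normals it also gives the additivity of wedges in their angle.\<close>

lemma measure_three_half_balls:
  fixes a b c :: "real^'n::{finite,wellorder}"
  assumes "a \<noteq> 0" "b \<noteq> 0" "c \<noteq> 0"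
  shows "2 * measure lebesgue (half_ball a \<inter> half_ball b \<inter> half_ball c) =
    measure lebesgue (half_ball a \<inter> half_ball b) + measure lebesgue (half_ball b \<inter> half_ball c)
    + measure lebesgue (half_ball a \<inter> half_ball c) - measure lebesgue (cball (0::real^'n::{finite,wellorder}) 1) / 2"
proof -
  let ?m = "measure lebesgue :: (real^'n::{finite,wellorder}) set \<Rightarrow> real"
  have "half_ball (-a) \<inter> half_ball (-b) \<inter> half_ball (-c) = uminus ` (half_ball a \<inter> half_ball b \<inter> half_ball c)"
    by (simp add: half_ball_uminus image_Int)
  then have T: "?m (half_ball (-a) \<inter> half_ball (-b) \<inter> half_ball (-c)) = ?m (half_ball a \<inter> half_ball b \<inter> half_ball c)"
    by (metis measure_orthogonal_image orthogonal_transformation_uminus fmeasurable.Int half_ball_lmeasurable)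
  have split1: "?m (half_ball p) = ?m (half_ball p \<inter> half_ball n) + ?m (half_ball p \<inter> half_ball (- n))"
    if "n \<noteq> 0" for n p
    using that by (intro measure_half_ball_split) (simp_all add: half_ball_subset_cball)
  have split2: "?m (half_ball p \<inter> half_ball q) =
      ?m (half_ball p \<inter> half_ball q \<inter> half_ball n) + ?m (half_ball p \<inter> half_ball q \<inter> half_ball (- n))"
    if "n \<noteq> 0" for n p q
    using that half_ball_subset_cball[of p] by (intro measure_half_ball_split) (auto intro: fmeasurable.Int)
  have "?m (half_ball a \<inter> half_ball b) = ?m (half_ball a \<inter> half_ball b \<inter> half_ball c) + ?m (half_ball a \<inter> half_ball b \<inter> half_ball (-c))"
    using split2[of c "a" "b"] assms by (simp add: Int_ac)
  moreover have "?m (half_ball (-c)) = ?m (half_ball a \<inter> half_ball (-c)) + ?m (half_ball (-a) \<inter> half_ball (-c))"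
    using split1[of a "-c"] assms by (simp add: Int_ac)
  moreover have "?m (half_ball a \<inter> half_ball (-c)) = ?m (half_ball a \<inter> half_ball b \<inter> half_ball (-c)) + ?m (half_ball a \<inter> half_ball (-b) \<inter> half_ball (-c))"
    using split2[of b "a" "-c"] assms by (simp add: Int_ac)
  moreover have "?m (half_ball (-a) \<inter> half_ball (-c)) = ?m (half_ball (-a) \<inter> half_ball b \<inter> half_ball (-c)) + ?m (half_ball (-a) \<inter> half_ball (-b) \<inter> half_ball (-c))"
    using split2[of b "-a" "-c"] assms by (simp add: Int_ac)
  moreover have "?m (half_ball a) = ?m (half_ball a \<inter> half_ball c) + ?m (half_ball a \<inter> half_ball (-c))"
    using split1[of c "a"] assms by (simp add: Int_ac)
  moreover have "?m (half_ball b) = ?m (half_ball b \<inter> half_ball c) + ?m (half_ball b \<inter> half_ball (-c))"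
    using split1[of c "b"] assms by (simp add: Int_ac)
  moreover have "?m (half_ball b \<inter> half_ball (-c)) = ?m (half_ball a \<inter> half_ball b \<inter> half_ball (-c)) + ?m (half_ball (-a) \<inter> half_ball b \<inter> half_ball (-c))"
    using split2[of a "b" "-c"] assms by (simp add: Int_ac)
  moreover have "?m (half_ball (- c)) = ?m (cball 0 1) / 2"
    using assms by (intro measure_half_ball) simp
  ultimately show ?thesis
    using T measure_half_ball[OF assms(1)] measure_half_ball[OF assms(2)] by linarith
qed

text \<open>Let \<open>W t\<close> be the volume of the wedge whose normals make the angle \<open>t\<close>, and \<open>g\<close> its deviation from
the claimed value. If a normal lies between two others, then the half-balls of the outer two
intersect inside its own half-ball, so inclusion and exclusion makes \<open>g\<close> additive. Moreover
\<open>g (pi - t) = - g t\<close>, since two complementary wedges fill a half-ball. Doubling angles below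
\<open>pi / 2\<close> and reflecting the others shows that any bound for \<open>g\<close> can be halved, so \<open>g = 0\<close>.\<close>

lemma measure_wedge:
  fixes a b :: "real^3"
  assumes n: "norm a = 1" "norm b = 1" and "a \<bullet> b \<noteq> -1"
  shows "measure lebesgue (half_ball a \<inter> half_ball b) = 2 / 3 * (pi - arccos (a \<bullet> b))"
proof -
  define e :: "real \<Rightarrow> real^3" where "e t = cos t *\<^sub>R axis 1 1 + sin t *\<^sub>R axis 2 1" for t
  have inner_e: "e s \<bullet> e t = cos (t - s)" for s t
    by (simp add: e_def inner_add_left inner_add_right inner_axis_axis cos_diff)
  have norm_e: "norm (e t) = 1" for t
    by (simp add: norm_eq_sqrt_inner inner_e)
  have e_nz: "e t \<noteq> 0" for t
    using norm_e[of t] by auto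
  define W where "W t = measure lebesgue (half_ball (e 0) \<inter> half_ball (e t))" for t
  have W_eq: "measure lebesgue (half_ball p \<inter> half_ball q) = W t"
    if "norm p = 1" "norm q = 1" "p \<bullet> q = cos t" for p q :: "real^3" and t
    unfolding W_def by (rule measure_wedge_cong) (use that in \<open>simp_all add: norm_e inner_e\<close>)
  have vol: "measure lebesgue (cball (0::real^3) 1) = 4 / 3 * pi"
    by (simp add: content_cball unit_ball_vol_3)
  define g where "g t = W t - 2 / 3 * (pi - t)" for t
  have add: "g (s + t) = g s + g t" if "0 \<le> s" "0 \<le> t" "s + t < pi" for s t
  proof (cases "s + t = 0")
    case True
    then have "s = 0" "t = 0"
      using that by auto
    moreover have "W 0 = 2 / 3 * pi"
      using measure_half_ball[OF e_nz] by (simp add: W_def vol)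
    ultimately show ?thesis
      by (simp add: g_def)
  next
    case False
    with that have "sin (s + t) > 0" "sin s \<ge> 0" "sin t \<ge> 0"
      by (auto intro: sin_gt_zero sin_ge_zero)
    moreover have "sin (s + t) *\<^sub>R e s = sin t *\<^sub>R e 0 + sin s *\<^sub>R e (s + t)"
    proof -
      have "sin t + sin s * cos (s + t) = sin (s + t) * cos s"
        using sin_diff[of "s + t" s] by (simp add: algebra_simps)
      then show ?thesis
        by (simp add: e_def scaleR_add_right scaleR_add_left[symmetric] mult.commute flip: add.assoc)
    qed
    then have "sin (s + t) * (e s \<bullet> x) = sin t * (e 0 \<bullet> x) + sin s * (e (s + t) \<bullet> x)" for x
      by (metis inner_add_left inner_scaleR_left)
    ultimately have "0 \<le> e s \<bullet> x" if "0 \<le> e 0 \<bullet> x" "0 \<le> e (s + t) \<bullet> x" for x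
      using that by (metis add_nonneg_nonneg mult_nonneg_nonneg zero_le_mult_iff not_less)
    then have "half_ball (e 0) \<inter> half_ball (e s) \<inter> half_ball (e (s + t)) = half_ball (e 0) \<inter> half_ball (e (s + t))"
      by (auto simp: half_ball_def)
    then have "2 * W (s + t) = W s + W t + W (s + t) - 2 / 3 * pi"
      using measure_three_half_balls[OF e_nz e_nz e_nz, of 0 s "s + t"]
        W_eq[OF norm_e norm_e, of s "s + t" t]
      by (simp add: vol inner_e W_def)
    then show ?thesis
      by (simp add: g_def field_simps)
  qed
  have refl: "g (pi - t) = - g t" for t
  proof -
    have "2 / 3 * pi = measure lebesgue (half_ball (e 0))"
      using measure_half_ball[OF e_nz] by (simp add: vol)
    also have "\<dots> = W t + measure lebesgue (half_ball (e 0) \<inter> half_ball (- e t))"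
      unfolding W_def by (intro measure_half_ball_split e_nz half_ball_subset_cball half_ball_lmeasurable)
    also have "measure lebesgue (half_ball (e 0) \<inter> half_ball (- e t)) = W (pi - t)"
      by (intro W_eq) (simp_all add: norm_e inner_e)
    finally show ?thesis
      by (simp add: g_def algebra_simps)
  qed
  have "\<bar>g t\<bar> \<le> 4 * pi / 2 ^ k" if "0 \<le> t" "t < pi" for t k
    using that
  proof (induction k arbitrary: t)
    case 0
    have "W t \<le> measure lebesgue (half_ball (e 0))"
      unfolding W_def by (intro measure_mono_fmeasurable) (auto intro!: fmeasurableD fmeasurable.Int)
    then have "W t \<le> 2 / 3 * pi"
      using measure_half_ball[OF e_nz, of 0] by (simp add: vol)
    moreover have "0 \<le> W t"
      by (simp add: W_def)
    ultimately show ?case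
      using 0 by (simp add: g_def abs_le_iff) argo
  next
    case (Suc k)
    have half: "\<bar>g r\<bar> \<le> 4 * pi / 2 ^ Suc k" if "0 \<le> r" "r < pi / 2" for r
      using Suc.IH[of "2 * r"] add[of r r] that by (simp add: field_simps abs_mult)
    consider "t < pi / 2" | "t = pi / 2" | "t > pi / 2"
      by linarith
    then show ?case
    proof cases
      case 1
      with half Suc.prems show ?thesis by blast
    next
      case 2
      then have "pi - t = t"
        by simp
      then have "g t = - g t"
        using refl[of t] by metis
      then have "g t = 0"
        by simp
      then show ?thesis by simp
    next
      case 3
      with half[of "pi - t"] Suc.prems show ?thesis
        by (simp add: refl)
    qed
  qed
  moreover have "(\<lambda>k. 4 * pi / 2 ^ k) \<longlonglongrightarrow> 0"
    by real_asymp
  ultimately have "g t = 0" if "0 \<le> t" "t < pi" for t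
    using that LIMSEQ_le_const[of "\<lambda>k. 4 * pi / 2 ^ k" 0 "\<bar>g t\<bar>"] by auto
  moreover have ab: "\<bar>a \<bullet> b\<bar> \<le> 1"
    using Cauchy_Schwarz_ineq2[of a b] n by simp
  moreover have "arccos (a \<bullet> b) < pi"
    using ab assms(3) arccos_lt_bounded[of "a \<bullet> b"] by (cases "a \<bullet> b = 1") auto
  ultimately have "W (arccos (a \<bullet> b)) = 2 / 3 * (pi - arccos (a \<bullet> b))"
    by (simp add: g_def arccos_lbound)
  then show ?thesis
    using W_eq[OF n, of "arccos (a \<bullet> b)"] ab by (simp add: cos_arccos_abs)
qed

lemma half_ball_scaleR: "0 < c \<Longrightarrow> half_ball (c *\<^sub>R n) = half_ball n"
  by (simp add: half_ball_def zero_le_mult_iff)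

section \<open>Girard's formula\<close>

lemma triple_product_expansion:
  fixes A B C x :: "real^3"
  shows "(A \<bullet> cross3 B C) *\<^sub>R x =
    (cross3 B C \<bullet> x) *\<^sub>R A + (cross3 C A \<bullet> x) *\<^sub>R B + (cross3 A B \<bullet> x) *\<^sub>R C"
  unfolding vec_eq_iff forall_3 by (simp add: inner_vec_def sum_3 cross_components algebra_simps)

lemma triple_product_rotate: "B \<bullet> cross3 C A = A \<bullet> cross3 B C" "C \<bullet> cross3 A B = A \<bullet> cross3 B C"
  by (simp_all add: cross3_simps)

text \<open>The coordinates of \<open>x\<close> in the basis \<open>A\<close>, \<open>B\<close>, \<open>C\<close> are its inner products with the dual basis,
which consists of the pairwise cross products divided by the triple product. The cone consists
of the points of the ball with nonnegative coordinates. The sign \<open>s\<close> of the triple product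
accounts for the orientation of the triangle.\<close>

lemma cone_over_spherical_triangle:
  fixes A B C :: "real^3"
  assumes D: "A \<bullet> cross3 B C \<noteq> 0"
  defines "s \<equiv> sgn (A \<bullet> cross3 B C)"
  shows "{t *\<^sub>R x |t x. 0 \<le> t \<and> t \<le> 1 \<and> x \<in> spherical_triangle A B C} =
    half_ball (s *\<^sub>R cross3 B C) \<inter> half_ball (s *\<^sub>R cross3 C A) \<inter> half_ball (s *\<^sub>R cross3 A B)"
    (is "?cone = ?H")
proof
  have sD: "s * (A \<bullet> cross3 B C) = \<bar>A \<bullet> cross3 B C\<bar>"
    by (simp add: s_def abs_sgn mult.commute)
  show "?cone \<subseteq> ?H"
  proof
    fix y assume "y \<in> ?cone"
    then obtain t x where y: "y = t *\<^sub>R x" "0 \<le> t" "t \<le> 1" "x \<in> spherical_triangle A B C"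
      by blast
    then obtain u v w where uvw: "0 \<le> u" "0 \<le> v" "0 \<le> w" "x = sgn (u *\<^sub>R A + v *\<^sub>R B + w *\<^sub>R C)"
      by (auto simp: spherical_triangle_def convex_hull_3)
    define k where "k = t / norm (u *\<^sub>R A + v *\<^sub>R B + w *\<^sub>R C)"
    have k: "0 \<le> k" "y = k *\<^sub>R (u *\<^sub>R A + v *\<^sub>R B + w *\<^sub>R C)"
      using y uvw by (auto simp: k_def sgn_div_norm divide_inverse)
    have "norm y \<le> 1"
      using y uvw by (simp add: norm_sgn)
    moreover have "(s *\<^sub>R cross3 B C) \<bullet> y = k * (u * \<bar>A \<bullet> cross3 B C\<bar>)"
      unfolding k sD[symmetric] by (simp add: inner_add_right dot_cross_self) (simp add: inner_commute)
    moreover have "(s *\<^sub>R cross3 C A) \<bullet> y = k * (v * \<bar>A \<bullet> cross3 B C\<bar>)"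
    proof -
      have "(s *\<^sub>R cross3 C A) \<bullet> y = k * (v * (s * (B \<bullet> cross3 C A)))"
        unfolding k by (simp add: inner_add_right dot_cross_self) (simp add: inner_commute)
      then show ?thesis
        by (simp add: triple_product_rotate sD)
    qed
    moreover have "(s *\<^sub>R cross3 A B) \<bullet> y = k * (w * \<bar>A \<bullet> cross3 B C\<bar>)"
    proof -
      have "(s *\<^sub>R cross3 A B) \<bullet> y = k * (w * (s * (C \<bullet> cross3 A B)))"
        unfolding k by (simp add: inner_add_right dot_cross_self) (simp add: inner_commute)
      then show ?thesis
        by (simp add: triple_product_rotate sD)
    qed
    ultimately show "y \<in> ?H"
      using k(1) uvw(1-3) unfolding half_ball_def by (auto simp del: inner_scaleR_left inner_scaleR_right)
  qed
  show "?H \<subseteq> ?cone"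
  proof
    fix x assume x: "x \<in> ?H"
    show "x \<in> ?cone"
    proof (cases "x = 0")
      case True
      have "A \<noteq> 0"
        using D by auto
      then have "sgn A \<in> spherical_triangle A B C"
        by (auto simp: spherical_triangle_def intro!: imageI hull_inc)
      then have "x = 0 *\<^sub>R sgn A \<and> 0 \<le> (0::real) \<and> (0::real) \<le> 1 \<and> sgn A \<in> spherical_triangle A B C"
        using True by simp
      then show ?thesis
        by blast
    next
      case False
      define p q r where "p = s * (cross3 B C \<bullet> x)" and "q = s * (cross3 C A \<bullet> x)" and "r = s * (cross3 A B \<bullet> x)"
      have nonneg: "0 \<le> p" "0 \<le> q" "0 \<le> r"
        using x by (simp_all add: half_ball_def p_def q_def r_def)
      have Dx: "\<bar>A \<bullet> cross3 B C\<bar> *\<^sub>R x = p *\<^sub>R A + q *\<^sub>R B + r *\<^sub>R C"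
        unfolding sD[symmetric] scaleR_scaleR[symmetric] triple_product_expansion
        by (simp add: p_def q_def r_def scaleR_add_right)
      define m where "m = p + q + r"
      have "m \<noteq> 0"
      proof
        assume "m = 0"
        then have "p = 0" "q = 0" "r = 0"
          using nonneg by (auto simp: m_def)
        then show False
          using Dx D False by simp
      qed
      then have m: "m > 0"
        using nonneg by (simp add: m_def)
      define y where "y = (\<bar>A \<bullet> cross3 B C\<bar> / m) *\<^sub>R x"
      have "y = (p / m) *\<^sub>R A + (q / m) *\<^sub>R B + (r / m) *\<^sub>R C"
        using arg_cong[OF Dx, of "scaleR (1 / m)"] by (simp add: y_def scaleR_add_right)
      moreover have "p / m + q / m + r / m = 1"
        using m by (simp add: m_def flip: add_divide_distrib)
      ultimately have "y \<in> convex hull {A, B, C}"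
        using nonneg m unfolding convex_hull_3 by (smt (verit) divide_nonneg_pos mem_Collect_eq)
      moreover have "y \<noteq> 0"
        using D False m by (simp add: y_def)
      moreover have "sgn y = sgn x"
        using D m by (simp add: y_def sgn_scaleR)
      ultimately have "sgn x \<in> spherical_triangle A B C"
        unfolding spherical_triangle_def by (metis Diff_iff empty_iff imageI insert_iff)
      moreover have "x = norm x *\<^sub>R sgn x" "norm x \<le> 1"
        using x False by (auto simp: sgn_div_norm half_ball_def)
      ultimately show ?thesis
        by (smt (verit) mem_Collect_eq norm_ge_zero)
    qed
  qed
qed

text \<open>The angle of the spherical triangle at the vertex \<open>A\<close>, that is, between the planes \<open>OAB\<close> and
\<open>OAC\<close>. The formula is the spherical law of cosines.\<close>

definition dihedral_angle :: "real^3 \<Rightarrow> real^3 \<Rightarrow> real^3 \<Rightarrow> real" where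
  "dihedral_angle A B C =
    arccos ((B \<bullet> C - (A \<bullet> B) * (A \<bullet> C)) / (norm (cross3 A B) * norm (cross3 A C)))"

lemma triple_product_square:
  fixes A B C :: "real^3"
  shows "(A \<bullet> cross3 B C)\<^sup>2 = (A \<bullet> A) * (B \<bullet> B) * (C \<bullet> C) + 2 * (A \<bullet> B) * (B \<bullet> C) * (C \<bullet> A)
    - (A \<bullet> A) * (B \<bullet> C)\<^sup>2 - (B \<bullet> B) * (C \<bullet> A)\<^sup>2 - (C \<bullet> C) * (A \<bullet> B)\<^sup>2"
  by (simp add: inner_vec_def sum_3 cross_components power2_eq_square algebra_simps)

lemma norm_cross3_unit:
  assumes "norm A = 1" "norm B = 1"
  shows "(norm (cross3 A B))\<^sup>2 = 1 - (A \<bullet> B)\<^sup>2"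
  using norm_cross_dot[of A B] assms by simp

text \<open>For unit vectors the square of the triple product is a Gram determinant, and together with the
square of the numerator it adds up to the square of the denominator. So the sine of the angle is
the triple product over the same denominator. As the exponential of the angle is thus
explicit in the inner products, the three exponentials of a triangle can be multiplied below.\<close>

lemma cis_dihedral_angle:
  fixes A B C :: "real^3"
  assumes n: "norm A = 1" "norm B = 1" "norm C = 1" and D: "A \<bullet> cross3 B C \<noteq> 0"
  shows "norm (cross3 A B) > 0" "norm (cross3 A C) > 0"
    and "cis (dihedral_angle A B C) =
      Complex (B \<bullet> C - (A \<bullet> B) * (A \<bullet> C)) \<bar>A \<bullet> cross3 B C\<bar> / of_real (norm (cross3 A B) * norm (cross3 A C))"
    and "dihedral_angle A B C < pi"
    and "dihedral_angle A B C = pi - arccos (- ((B \<bullet> C - (A \<bullet> B) * (A \<bullet> C)) / (norm (cross3 A B) * norm (cross3 A C))))"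
    and "- ((B \<bullet> C - (A \<bullet> B) * (A \<bullet> C)) / (norm (cross3 A B) * norm (cross3 A C))) \<noteq> -1"
proof -
  have unit: "A \<bullet> A = 1" "B \<bullet> B = 1" "C \<bullet> C = 1"
    using n by (simp_all add: dot_square_norm)
  show AB: "norm (cross3 A B) > 0"
    using D triple_product_rotate(2)[of C A B] by auto
  show AC: "norm (cross3 A C) > 0"
    using D triple_product_rotate(1)[of B C A] cross_skew[of C A] by auto
  define N where "N = norm (cross3 A B) * norm (cross3 A C)"
  define p where "p = B \<bullet> C - (A \<bullet> B) * (A \<bullet> C)"
  have N: "N > 0"
    using AB AC by (simp add: N_def)
  have "N\<^sup>2 = (norm (cross3 A B))\<^sup>2 * (norm (cross3 A C))\<^sup>2"
    by (simp add: N_def power_mult_distrib)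
  also have "\<dots> = (1 - (A \<bullet> B)\<^sup>2) * (1 - (A \<bullet> C)\<^sup>2)"
    using n by (simp add: norm_cross3_unit)
  finally have sq: "p\<^sup>2 + (A \<bullet> cross3 B C)\<^sup>2 = N\<^sup>2"
    unfolding triple_product_square p_def by (simp add: unit inner_commute power2_eq_square algebra_simps)
  then have sum1: "(p / N)\<^sup>2 + (\<bar>A \<bullet> cross3 B C\<bar> / N)\<^sup>2 = 1"
    using N by (simp add: power_divide flip: add_divide_distrib)
  moreover have "(\<bar>A \<bullet> cross3 B C\<bar> / N)\<^sup>2 > 0"
    using D N by simp
  ultimately have lt: "\<bar>p / N\<bar> < 1"
    by (metis abs_square_less_1 less_add_same_cancel1)
  show "cis (dihedral_angle A B C) =
      Complex (B \<bullet> C - (A \<bullet> B) * (A \<bullet> C)) \<bar>A \<bullet> cross3 B C\<bar> / of_real (norm (cross3 A B) * norm (cross3 A C))"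
  proof -
    have "sin (arccos (p / N)) = sqrt (1 - (p / N)\<^sup>2)"
      using lt by (intro sin_arccos_abs) simp
    also have "\<dots> = \<bar>A \<bullet> cross3 B C\<bar> / N"
      using sum1 N by (intro real_sqrt_unique) (simp_all add: algebra_simps)
    finally show ?thesis
      unfolding dihedral_angle_def p_def[symmetric] N_def[symmetric]
      using lt by (simp add: complex_eq_iff cos_arccos_abs)
  qed
  show "dihedral_angle A B C < pi"
    unfolding dihedral_angle_def p_def[symmetric] N_def[symmetric]
    using lt arccos_lt_bounded[of "p / N"] unfolding abs_less_iff by auto
  show "dihedral_angle A B C = pi - arccos (- ((B \<bullet> C - (A \<bullet> B) * (A \<bullet> C)) / (norm (cross3 A B) * norm (cross3 A C))))"
    unfolding dihedral_angle_def p_def[symmetric] N_def[symmetric]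
    using lt arccos_minus[of "p / N"] unfolding abs_less_iff by auto
  show "- ((B \<bullet> C - (A \<bullet> B) * (A \<bullet> C)) / (norm (cross3 A B) * norm (cross3 A C))) \<noteq> -1"
    unfolding p_def[symmetric] N_def[symmetric] using lt by auto
qed

text \<open>The normals \<open>A \<times> B\<close> and \<open>C \<times> A\<close> both point into the trihedral cone, or both out of it. In either
case the angle between them is supplementary to the dihedral angle.\<close>

lemma measure_dihedral_wedge:
  fixes A B C :: "real^3"
  assumes n: "norm A = 1" "norm B = 1" "norm C = 1" and D: "A \<bullet> cross3 B C \<noteq> 0" and s: "\<bar>s\<bar> = 1"
  shows "measure lebesgue (half_ball (s *\<^sub>R cross3 A B) \<inter> half_ball (s *\<^sub>R cross3 C A))
    = 2 / 3 * dihedral_angle A B C"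
proof -
  note dih = cis_dihedral_angle[OF n D]
  define a where "a = (s / norm (cross3 A B)) *\<^sub>R cross3 A B"
  define b where "b = (s / norm (cross3 A C)) *\<^sub>R cross3 C A"
  have eq: "norm (cross3 C A) = norm (cross3 A C)"
    using cross_skew[of C A] by simp
  have ss: "s * s = 1"
    using s by (metis abs_mult_self_eq mult_1)
  have "a \<bullet> b = - ((B \<bullet> C - (A \<bullet> B) * (A \<bullet> C)) / (norm (cross3 A B) * norm (cross3 A C)))"
  proof -
    have "cross3 A B \<bullet> cross3 C A = (A \<bullet> B) * (A \<bullet> C) - (A \<bullet> A) * (B \<bullet> C)"
      by (simp add: inner_vec_def sum_3 cross_components algebra_simps)
    moreover have "A \<bullet> A = 1"
      using n by (simp add: dot_square_norm)
    ultimately show ?thesis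
      using ss by (simp add: a_def b_def diff_divide_distrib[symmetric] mult.assoc[symmetric] minus_divide_left)
  qed
  moreover have "norm a = 1" "norm b = 1"
    using dih(1,2) s by (simp_all add: a_def b_def eq)
  ultimately have "measure lebesgue (half_ball a \<inter> half_ball b) = 2 / 3 * dihedral_angle A B C"
    using measure_wedge[of a b] dih(5,6) by simp
  moreover have "half_ball a = half_ball (s *\<^sub>R cross3 A B)"
    unfolding a_def using half_ball_scaleR[of "1 / norm (cross3 A B)" "s *\<^sub>R cross3 A B"] dih(1) by simp
  moreover have "half_ball b = half_ball (s *\<^sub>R cross3 C A)"
    unfolding b_def using half_ball_scaleR[of "1 / norm (cross3 A C)" "s *\<^sub>R cross3 C A"] dih(2) by simp
  ultimately show ?thesis
    by simp
qed

lemma girard_formula: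
  fixes A B C :: "real^3"
  assumes n: "norm A = 1" "norm B = 1" "norm C = 1" and D: "A \<bullet> cross3 B C \<noteq> 0"
  shows "spherical_area A B C = dihedral_angle A B C + dihedral_angle B C A + dihedral_angle C A B - pi"
proof -
  define s where "s = sgn (A \<bullet> cross3 B C)"
  have s: "\<bar>s\<bar> = 1"
    using D by (simp add: s_def abs_sgn_eq)
  then have nz: "s \<noteq> 0"
    by auto
  have D': "B \<bullet> cross3 C A \<noteq> 0" "C \<bullet> cross3 A B \<noteq> 0"
    using D by (simp_all add: triple_product_rotate)
  have vol: "measure lebesgue (cball (0::real^3) 1) = 4 / 3 * pi"
    by (simp add: content_cball unit_ball_vol_3)
  have "s *\<^sub>R cross3 B C \<noteq> 0" "s *\<^sub>R cross3 C A \<noteq> 0" "s *\<^sub>R cross3 A B \<noteq> 0"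
    using nz D D' by auto
  from measure_three_half_balls[OF this]
  have "spherical_area A B C = 3 / 2 * (2 / 3 * dihedral_angle C A B + 2 / 3 * dihedral_angle A B C
      + 2 / 3 * dihedral_angle B C A - 2 / 3 * pi)"
    unfolding spherical_area_def sphere_area_def cone_over_spherical_triangle[OF D, folded s_def]
    using measure_dihedral_wedge[OF n D s] measure_dihedral_wedge[OF n(2,3,1) D'(1) s]
      measure_dihedral_wedge[OF n(3,1,2) D'(2) s]
    by (simp add: vol Int_ac)
  then show ?thesis
    by (simp add: field_simps)
qed

section \<open>The spherical area as a function of the inner products\<close>

text \<open>Girard's formula turns the exponential of the area into a product of three explicit complex
numbers, which simplifies to a positive multiple of the square of the argument \<open>z\<close> of \<open>Arg\<close>. Area
and \<open>2 * Arg z\<close> both lie in \<open>[0, 2 pi)\<close>, hence they agree. This is the formula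
\<open>tan (area / 2) = D / w\<close> of Van Oosterom and Strackee; with \<open>Arg\<close> it stays valid
for areas of \<open>pi\<close> and more, where \<open>w \<le> 0\<close>.\<close>

lemma spherical_area_eq_Arg:
  fixes A B C :: "real^3"
  assumes n: "norm A = 1" "norm B = 1" "norm C = 1" and D: "A \<bullet> cross3 B C \<noteq> 0"
  shows "spherical_area A B C =
    2 * Arg (Complex (1 + A \<bullet> B + B \<bullet> C + C \<bullet> A) \<bar>A \<bullet> cross3 B C\<bar>)"
proof -
  define a b c d where "a = B \<bullet> C" and "b = C \<bullet> A" and "c = A \<bullet> B" and "d = \<bar>A \<bullet> cross3 B C\<bar>"
  define z where "z = Complex (1 + c + a + b) d"
  have D': "B \<bullet> cross3 C A \<noteq> 0" "C \<bullet> cross3 A B \<noteq> 0"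
    using D by (simp_all add: triple_product_rotate)
  note dA = cis_dihedral_angle[OF n D]
  note dB = cis_dihedral_angle[OF n(2,3,1) D'(1)]
  note dC = cis_dihedral_angle[OF n(3,1,2) D'(2)]
  have unit: "A \<bullet> A = 1" "B \<bullet> B = 1" "C \<bullet> C = 1"
    using n by (simp_all add: dot_square_norm)
  have d2: "d\<^sup>2 = 1 + 2 * a * b * c - a\<^sup>2 - b\<^sup>2 - c\<^sup>2"
    by (simp add: d_def triple_product_square unit a_def b_def c_def)
  have d: "d > 0"
    using D by (simp add: d_def)
  define P where "P = (norm (cross3 A B) * norm (cross3 B C) * norm (cross3 C A))\<^sup>2"
  have P: "P = (1 - a\<^sup>2) * (1 - b\<^sup>2) * (1 - c\<^sup>2)"
    using n by (simp add: P_def power_mult_distrib norm_cross3_unit a_def b_def c_def)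
  have P0: "P > 0"
    using dA(1) dB(1) dC(1) by (simp add: P_def)
  have prod: "Complex (a - c * b) d * Complex (b - a * c) d * Complex (c - b * a) d
      = - of_real ((1 - a) * (1 - b) * (1 - c) / 2) * z\<^sup>2"
  proof -
    (* e stands for the square of d, so that both parts become polynomial identities in a, b, c *)
    have re: "2 * ((a - c * b) * (b - a * c) * (c - b * a) - e * ((a - c * b) + (b - a * c) + (c - b * a)))
        = - ((1 - a) * (1 - b) * (1 - c) * ((1 + c + a + b)\<^sup>2 - e))"
      if "e = 1 + 2 * a * b * c - a\<^sup>2 - b\<^sup>2 - c\<^sup>2" for e
      unfolding that by algebra
    have im: "((a - c * b) * (b - a * c) + (b - a * c) * (c - b * a) + (c - b * a) * (a - c * b)) - e
        = - ((1 - a) * (1 - b) * (1 - c) * (1 + c + a + b))"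
      if "e = 1 + 2 * a * b * c - a\<^sup>2 - b\<^sup>2 - c\<^sup>2" for e
      unfolding that by algebra
    have Re_z: "Re (z\<^sup>2) = (1 + c + a + b)\<^sup>2 - d\<^sup>2" and Im_z: "Im (z\<^sup>2) = 2 * d * (1 + c + a + b)"
      by (simp_all add: z_def power2_eq_square algebra_simps)
    have Re_prod: "Re (Complex (a - c * b) d * Complex (b - a * c) d * Complex (c - b * a) d)
        = (a - c * b) * (b - a * c) * (c - b * a) - d\<^sup>2 * ((a - c * b) + (b - a * c) + (c - b * a))"
      by (simp add: power2_eq_square algebra_simps)
    have Im_prod: "Im (Complex (a - c * b) d * Complex (b - a * c) d * Complex (c - b * a) d)
        = d * (((a - c * b) * (b - a * c) + (b - a * c) * (c - b * a) + (c - b * a) * (a - c * b)) - d\<^sup>2)"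
      by (simp add: power2_eq_square algebra_simps)
    have scale: "Re (- of_real K * u) = - (K * Re u)" "Im (- of_real K * u) = - (K * Im u)" for K u
      by simp_all
    show ?thesis
    proof (rule complex_eqI)
      show "Re (Complex (a - c * b) d * Complex (b - a * c) d * Complex (c - b * a) d)
          = Re (- of_real ((1 - a) * (1 - b) * (1 - c) / 2) * z\<^sup>2)"
        unfolding Re_prod scale Re_z
        using re[OF d2] by simp
      show "Im (Complex (a - c * b) d * Complex (b - a * c) d * Complex (c - b * a) d)
          = Im (- of_real ((1 - a) * (1 - b) * (1 - c) / 2) * z\<^sup>2)"
        unfolding Im_prod im[OF d2] scale Im_z by simp
    qed
  qed
  have skew: "norm (cross3 X Y) = norm (cross3 Y X)" for X Y
    by (metis cross_skew norm_minus_cancel)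
  have cis_area: "cis (spherical_area A B C) = of_real (((1 - a) * (1 - b) * (1 - c) / 2) / P) * z\<^sup>2"
  proof -
    have "cis (spherical_area A B C) =
        - (cis (dihedral_angle A B C) * cis (dihedral_angle B C A) * cis (dihedral_angle C A B))"
      unfolding girard_formula[OF n D] by (simp add: cis_mult flip: cis_divide)
    also have "\<dots> = - ((Complex (a - c * b) d * Complex (b - a * c) d * Complex (c - b * a) d) / of_real P)"
      unfolding dA(3) dB(3) dC(3) P_def a_def b_def c_def d_def
      by (simp add: skew[of A C] skew[of B A] skew[of C B] triple_product_rotate inner_commute power2_eq_square mult_ac)
    also have "\<dots> = of_real (((1 - a) * (1 - b) * (1 - c) / 2) / P) * z\<^sup>2"
      unfolding prod by simp
    finally show ?thesis .
  qed
  have z0: "z \<noteq> 0"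
    using d by (simp add: z_def complex_eq_iff)
  have Argz: "0 < Arg z" "Arg z < pi"
    using d Arg_lt_pi[of z] by (auto simp: z_def)
  have z_polar: "z = of_real (norm z) * exp (\<i> * Arg z)"
    using Arg_eq[OF z0] .
  have k: "of_real (cmod z ^ 2 * (((1 - a) * (1 - b) * (1 - c) / 2) / P)) * exp (\<i> * of_real (2 * Arg z)) = cis (spherical_area A B C)"
  proof -
    have "\<i> * complex_of_real (2 * Arg z) = 2 * (\<i> * Arg z)"
      by simp
    then have "of_real (cmod z ^ 2) * exp (\<i> * of_real (2 * Arg z)) = (of_real (cmod z) * exp (\<i> * Arg z))\<^sup>2"
      by (simp only: exp_double power_mult_distrib of_real_power)
    also have "\<dots> = z\<^sup>2"
      using z_polar by simp
    finally have "z\<^sup>2 = of_real (cmod z ^ 2) * exp (\<i> * of_real (2 * Arg z))"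
      by (rule sym)
    then show ?thesis
      by (simp only: cis_area of_real_mult mult_ac)
  qed
  have abs1: "\<bar>a\<bar> \<le> 1" "\<bar>b\<bar> \<le> 1" "\<bar>c\<bar> \<le> 1"
    using Cauchy_Schwarz_ineq2[of B C] Cauchy_Schwarz_ineq2[of C A] Cauchy_Schwarz_ineq2[of A B] n
    by (simp_all add: a_def b_def c_def)
  have pos: "(1 - a) * (1 - b) * (1 - c) > 0"
  proof -
    have "a \<noteq> 1" "b \<noteq> 1" "c \<noteq> 1"
      using P0 unfolding P by auto
    then show ?thesis
      using abs1 by (simp add: abs_le_iff less_le)
  qed
  have "Arg2pi (cis (spherical_area A B C)) = 2 * Arg z"
    by (rule Arg2pi_unique[OF k]) (use pos P0 z0 Argz in auto)
  moreover have "Arg2pi (cis (spherical_area A B C)) = spherical_area A B C"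
  proof (rule Arg2pi_unique)
    show "of_real 1 * exp (\<i> * of_real (spherical_area A B C)) = cis (spherical_area A B C)"
      by (simp add: cis_conv_exp)
    show "0 \<le> spherical_area A B C"
      by (simp add: spherical_area_def sphere_area_def)
    show "spherical_area A B C < 2 * pi"
      unfolding girard_formula[OF n D] using dA(4) dB(4) dC(4) by simp
  qed simp
  ultimately show ?thesis
    by (simp add: z_def a_def b_def c_def d_def)
qed

text \<open>The cross product is normal to the plane \<open>ABC\<close>. If the triple product vanishes, then this plane,
and with it the cone over the spherical triangle, lies in a hyperplane through the centre.\<close>

lemma triple_product_edges:
  fixes A B C :: "real^3"
  shows "cross3 (B - A) (C - A) \<bullet> A = A \<bullet> cross3 B C" "cross3 (B - A) (C - A) \<bullet> B = A \<bullet> cross3 B C"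
    "cross3 (B - A) (C - A) \<bullet> C = A \<bullet> cross3 B C"
  by (simp_all add: inner_vec_def sum_3 cross_components algebra_simps)

lemma spherical_area_coplanar:
  fixes A B C :: "real^3"
  assumes nc: "\<not> collinear {A, B, C}" and D: "A \<bullet> cross3 B C = 0"
  shows "spherical_area A B C = 0"
proof -
  define n where "n = cross3 (B - A) (C - A)"
  have "{B, A, C} = {A, B, C}"
    by auto
  then have n0: "n \<noteq> 0"
    using nc by (metis collinear_3 cross_eq_0 n_def NO_MATCH_def)
  have "{t *\<^sub>R x |t x. 0 \<le> t \<and> t \<le> 1 \<and> x \<in> spherical_triangle A B C} \<subseteq> {x. n \<bullet> x = 0}"
    using D triple_product_edges[of B A C, folded n_def]
    by (auto simp: spherical_triangle_def convex_hull_3 sgn_div_norm inner_add_right)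
  then have "negligible {t *\<^sub>R x |t x. 0 \<le> t \<and> t \<le> 1 \<and> x \<in> spherical_triangle A B C}"
    using negligible_hyperplane[of n 0] n0 negligible_subset by blast
  then show ?thesis
    by (simp add: spherical_area_def sphere_area_def negligible_imp_measure0)
qed

text \<open>All facial tetrahedra are linear images of a fixed one, whose volume serves as the unit.\<close>

lemma measure_facial_tetrahedron:
  fixes A B C :: "real^3"
  shows "measure lebesgue (facial_tetrahedron A B C) =
    \<bar>A \<bullet> cross3 B C\<bar> * measure lebesgue (facial_tetrahedron (axis 1 1) (axis 2 1) (axis 3 1))"
proof -
  define M :: "real^3^3" where "M = transpose (vector [A, B, C])"
  have axes: "M *v axis 1 1 = A" "M *v axis 2 1 = B" "M *v axis 3 1 = C"
    by (simp_all add: M_def vec_eq_iff forall_3 transpose_def matrix_vector_mult_def sum_3 axis_def)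
  have "facial_tetrahedron A B C = (*v) M ` facial_tetrahedron (axis 1 1) (axis 2 1) (axis 3 1)"
    unfolding facial_tetrahedron_def convex_hull_linear_image[OF matrix_vector_mul_linear]
    by (simp add: axes)
  moreover have "facial_tetrahedron (axis 1 1) (axis 2 1) (axis 3 1) \<in> lmeasurable"
    unfolding facial_tetrahedron_def
    by (intro lmeasurable_compact compact_convex_hull finite_imp_compact) simp
  moreover have "det M = A \<bullet> cross3 B C"
    by (simp add: M_def det_transpose dot_cross_det)
  ultimately show ?thesis
    by (simp add: measure_linear_image)
qed

section \<open>Matching the area by an isosceles triangle\<close>

text \<open>In the notation of the introduction, \<open>D\<close> and \<open>w\<close> belong to the given triangle, of squared
circumradius \<open>x\<close>, and \<open>D' y\<close> and \<open>w' y\<close> to the isosceles triangle with the same angle and squared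
circumradius \<open>y\<close>. The proportion \<open>D' y * w = D * w' y\<close> says that the areas agree. It is a zero of
\<open>f\<close>, which is negative at \<open>0\<close> and nonnegative at \<open>x\<close>: at the same circumradius the
isosceles triangle has at least the area of the given one.

The location of the zero gives the volume. Once \<open>w\<close> is positive (negative), \<open>D \<le> D' y\<close> follows
from the proportion if \<open>w' y\<close> is at least (at most) \<open>w\<close>. As \<open>w'\<close> decreases in \<open>y\<close>, the zero
should lie below (above) the point \<open>y0\<close> with \<open>w' y0 = w\<close>. The intermediate value theorem
provides such a zero: if \<open>y0 \<le> x\<close>, then \<open>D \<le> D' y0\<close> determines the sign of \<open>f y0\<close>, and if \<open>y0 > x\<close>,
which occurs only for positive \<open>w\<close>, then \<open>x\<close> itself lies below \<open>y0\<close>. For \<open>w = 0\<close>, where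
both areas must be \<open>pi\<close>, \<open>y0\<close> itself is the zero.\<close>

lemma isosceles_parameter_exists:
  fixes c s x q :: real
  assumes s: "0 < s" "s\<^sup>2 + c\<^sup>2 = 1" and x: "0 < x" "x < 1" and q: "0 < q" "q \<le> 2 * x * (1 + c)"
  defines "D \<equiv> q * s * sqrt (1 - x)" and "w \<equiv> 4 - 4 * x * s\<^sup>2 - c * q"
  defines "D' \<equiv> \<lambda>y. 2 * y * (1 + c) * s * sqrt (1 - y)" and "w' \<equiv> \<lambda>y. 4 - 4 * y * s\<^sup>2 - c * (2 * y * (1 + c))"
  obtains y where "0 < y" "y < 1" "D' y * w = D * w' y" "D \<le> D' y"
proof -
  define k where "k = 2 * (1 + c) * (2 - c)"
  have s2: "s\<^sup>2 = (1 - c) * (1 + c)"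
    using s by (simp add: algebra_simps power2_eq_square)
  have "c\<^sup>2 < 1"
    using s zero_less_power[OF s(1), of 2] by linarith
  then have c: "-1 < c" "c < 1"
    by (auto simp: abs_square_less_1)
  have k: "k > 0"
    using c by (simp add: k_def)
  have w': "w' y = 4 - k * y" for y
    unfolding w'_def k_def s2 by (simp add: algebra_simps)
  have w'_antimono: "w' b \<le> w' a" if "a \<le> b" for a b
    using that k by (simp add: w')
  have D: "D > 0"
    using q s x by (simp add: D_def)
  define y0 where "y0 = (4 - w) / k"
  have w'_y0: "w' y0 = w"
    using k by (simp add: w' y0_def)
  have y0_ge: "q \<le> 2 * y0 * (1 + c)"
  proof -
    have "(2 - c) * q \<le> 2 * (1 - c) * (2 * x * (1 + c)) + c * q"
      using mult_left_mono[OF q(2), of "2 * (1 - c)"] c by (simp add: algebra_simps)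
    also have "\<dots> = 4 - w"
      by (simp add: w_def s2 algebra_simps)
    also have "\<dots> = k * y0"
      using k by (simp add: y0_def)
    also have "\<dots> = (2 - c) * (2 * y0 * (1 + c))"
      by (simp add: k_def)
    finally show ?thesis
      using c by simp
  qed
  then have y0: "y0 > 0"
    using q(1) c by (smt (verit) zero_less_mult_iff)
  have D'_ge: "D \<le> D' y0" if "y0 \<le> x"
  proof -
    have "q * s * sqrt (1 - x) \<le> (2 * y0 * (1 + c)) * s * sqrt (1 - y0)"
      using y0_ge that s q x y0 c by (intro mult_mono) auto
    then show ?thesis
      by (simp add: D_def D'_def)
  qed
  define f where "f y = D' y * w - D * w' y" for y
  have cont: "continuous_on S f" for S
    unfolding f_def D'_def w'_def by (intro continuous_intros)
  have f0: "f 0 < 0"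
    using D by (simp add: f_def D'_def w'_def)
  have xs2: "x * s\<^sup>2 < 1"
  proof -
    have "x * s\<^sup>2 < 1 * s\<^sup>2"
      using x s by (intro mult_strict_right_mono) auto
    then show ?thesis
      using s(2) zero_le_power2[of c] by linarith
  qed
  have fx: "f x \<ge> 0"
  proof -
    have "2 * x * (1 + c) * w - q * w' x = 4 * (2 * x * (1 + c) - q) * (1 - x * s\<^sup>2)"
      unfolding w_def w'_def by (simp add: algebra_simps)
    then have "2 * x * (1 + c) * w - q * w' x \<ge> 0"
      using q(2) xs2 by simp
    then have "s * sqrt (1 - x) * (2 * x * (1 + c) * w - q * w' x) \<ge> 0"
      using s x by simp
    then show ?thesis
      by (simp add: f_def D_def D'_def algebra_simps)
  qed
  have f_y0: "f y0 = w * (D' y0 - D)"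
    by (simp add: f_def w'_y0 algebra_simps)
  (* an obtuse or right angle (c <= 0) forces w > 0; an acute one gives y0 <= x *)
  have y0_le: "y0 \<le> x" if "w \<le> 0"
  proof -
    have "x * s\<^sup>2 < 1"
      using xs2 .
    then have "0 < c * q"
      using that by (simp add: w_def)
    then have "c > 0"
      using q(1) by (simp add: zero_less_mult_iff)
    then have "4 - w \<le> 4 * x * s\<^sup>2 + c * (2 * x * (1 + c))"
      using q(2) by (simp add: w_def)
    also have "\<dots> = k * x"
      by (simp add: k_def s2 algebra_simps)
    finally show ?thesis
      using k by (simp add: y0_def field_simps)
  qed
  consider "w > 0" | "w = 0" | "w < 0"
    by linarith
  then show ?thesis
  proof cases
    case 1
    define m where "m = min y0 x"
    have "f m \<ge> 0"
      using fx f_y0 1 D'_ge by (simp add: m_def min_def)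
    then obtain y where y: "0 \<le> y" "y \<le> m" "f y = 0"
      using IVT'[of f 0 0 m] f0 cont y0 x by (auto simp: m_def)
    have "y \<noteq> 0"
      using y f0 by auto
    have "D * w \<le> D * w' y"
      using w'_antimono[of y y0] y(2) D w'_y0 by (simp add: m_def)
    also have "\<dots> = D' y * w"
      using y(3) by (simp add: f_def)
    finally have "D \<le> D' y"
      using 1 by simp
    then show ?thesis
      using that[of y] y x \<open>y \<noteq> 0\<close> by (simp add: f_def m_def)
  next
    case 2
    have "y0 \<le> x"
      using y0_le 2 by simp
    then show ?thesis
      using that[of y0] y0 x D'_ge 2 w'_y0 by simp
  next
    case 3
    have "y0 \<le> x"
      using y0_le 3 by simp
    have "f y0 \<le> 0"
      using f_y0 3 D'_ge[OF \<open>y0 \<le> x\<close>] by (simp add: mult_nonpos_nonneg)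
    then obtain y where y: "y0 \<le> y" "y \<le> x" "f y = 0"
      using IVT'[of f y0 0 x] fx cont \<open>y0 \<le> x\<close> by auto
    have "D' y * w = D * w' y"
      using y(3) by (simp add: f_def)
    also have "\<dots> \<le> D * w"
      using w'_antimono[OF y(1)] D w'_y0 by simp
    finally have "D \<le> D' y"
      using 3 by simp
    then show ?thesis
      using that[of y] y x y0 by (simp add: f_def)
  qed
qed

section \<open>Rectilinear triangles and their parameters\<close>

text \<open>Up to the factor \<open>1 / 2\<close>, these are cosines in a triangle with sides \<open>p\<close>, \<open>q\<close>, \<open>L\<close>: the angle
opposite to the longest side \<open>L\<close> is the greatest, and at least \<open>pi / 3\<close>.\<close>

lemma cosine_opposite_longest_side:
  fixes p q L :: real
  assumes "0 < p" "0 < q" "p \<le> L" "q \<le> L"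
  shows "(p\<^sup>2 + q\<^sup>2 - L\<^sup>2) / (p * q) \<le> (L\<^sup>2 + q\<^sup>2 - p\<^sup>2) / (L * q)"
    and "(p\<^sup>2 + q\<^sup>2 - L\<^sup>2) / (p * q) \<le> 1"
proof -
  have "q\<^sup>2 \<le> (L + p)\<^sup>2"
    using assms by (intro power_mono) auto
  then have "0 \<le> (L - p) * ((L + p)\<^sup>2 - q\<^sup>2)"
    using assms by simp
  also have "\<dots> = p * (L\<^sup>2 + q\<^sup>2 - p\<^sup>2) - L * (p\<^sup>2 + q\<^sup>2 - L\<^sup>2)"
    by (simp add: power2_eq_square algebra_simps)
  finally have "L * (p\<^sup>2 + q\<^sup>2 - L\<^sup>2) \<le> p * (L\<^sup>2 + q\<^sup>2 - p\<^sup>2)"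
    by simp
  then show "(p\<^sup>2 + q\<^sup>2 - L\<^sup>2) / (p * q) \<le> (L\<^sup>2 + q\<^sup>2 - p\<^sup>2) / (L * q)"
    using assms by (simp add: divide_simps mult_ac)
  have "p\<^sup>2 \<le> L\<^sup>2" "q\<^sup>2 \<le> L\<^sup>2" "p\<^sup>2 \<le> p * q \<or> q\<^sup>2 \<le> p * q"
    using assms by (auto simp: power2_eq_square intro: mult_mono)
  then have "p\<^sup>2 + q\<^sup>2 - L\<^sup>2 \<le> p * q"
    by linarith
  then show "(p\<^sup>2 + q\<^sup>2 - L\<^sup>2) / (p * q) \<le> 1"
    using assms by (simp add: divide_le_eq_1)
qed

lemma law_of_cosines:
  fixes A B C :: "'a::real_inner"
  shows "2 * ((A - C) \<bullet> (B - C)) = (dist A C)\<^sup>2 + (dist B C)\<^sup>2 - (dist A B)\<^sup>2"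
  by (simp add: dist_norm power2_norm_eq_inner inner_diff_left inner_diff_right inner_commute)

lemma angle_at_sides:
  "angle_at A C B = arccos (((dist A C)\<^sup>2 + (dist B C)\<^sup>2 - (dist A B)\<^sup>2) / (dist A C * dist B C) / 2)"
  unfolding angle_at_def law_of_cosines[symmetric] by (simp add: dist_norm)

lemma angle_at_commute: "angle_at A C B = angle_at B C A"
  by (simp add: angle_at_def inner_commute mult.commute)

lemma law_of_cosines_quotient_bounds:
  fixes A B C :: "real^3"
  shows "-1 \<le> ((dist A C)\<^sup>2 + (dist B C)\<^sup>2 - (dist A B)\<^sup>2) / (dist A C * dist B C) / 2"
    and "((dist A C)\<^sup>2 + (dist B C)\<^sup>2 - (dist A B)\<^sup>2) / (dist A C * dist B C) / 2 \<le> 1"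
proof -
  have "\<bar>((dist A C)\<^sup>2 + (dist B C)\<^sup>2 - (dist A B)\<^sup>2) / (dist A C * dist B C) / 2\<bar> \<le> 1"
    unfolding law_of_cosines[symmetric]
    using Cauchy_Schwarz_ineq2[of "A - C" "B - C"] by (auto simp: dist_norm abs_mult divide_le_eq_1 simp del: inner_diff_left inner_diff_right)
  then show "-1 \<le> ((dist A C)\<^sup>2 + (dist B C)\<^sup>2 - (dist A B)\<^sup>2) / (dist A C * dist B C) / 2"
    and "((dist A C)\<^sup>2 + (dist B C)\<^sup>2 - (dist A B)\<^sup>2) / (dist A C * dist B C) / 2 \<le> 1"
    unfolding abs_le_iff by linarith+
qed

lemma greatest_central_angle_opposite_longest_edge:
  fixes A B C :: "real^3"
  assumes "A \<noteq> C" "B \<noteq> C" and le: "dist A C \<le> dist A B" "dist B C \<le> dist A B"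
  shows "greatest_central_angle A B C = angle_at A C B"
    and "((dist A C)\<^sup>2 + (dist B C)\<^sup>2 - (dist A B)\<^sup>2) / (dist A C * dist B C) / 2 \<le> 1 / 2"
proof -
  have pos: "dist A C > 0" "dist B C > 0"
    using assms by auto
  have "angle_at A B C \<le> angle_at A C B"
    unfolding angle_at_sides[of A C B] angle_at_sides[of A B C]
  proof (rule arccos_le_arccos)
    show "((dist A C)\<^sup>2 + (dist B C)\<^sup>2 - (dist A B)\<^sup>2) / (dist A C * dist B C) / 2
      \<le> ((dist A B)\<^sup>2 + (dist C B)\<^sup>2 - (dist A C)\<^sup>2) / (dist A B * dist C B) / 2"
      using cosine_opposite_longest_side(1)[OF pos le]
      by (intro divide_right_mono) (simp_all add: dist_commute[of C B])
  qed (rule law_of_cosines_quotient_bounds)+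
  moreover have "angle_at B A C \<le> angle_at A C B"
    unfolding angle_at_sides[of A C B] angle_at_sides[of B A C]
  proof (rule arccos_le_arccos)
    show "((dist A C)\<^sup>2 + (dist B C)\<^sup>2 - (dist A B)\<^sup>2) / (dist A C * dist B C) / 2
      \<le> ((dist B A)\<^sup>2 + (dist C A)\<^sup>2 - (dist B C)\<^sup>2) / (dist B A * dist C A) / 2"
      using cosine_opposite_longest_side(1)[OF pos(2,1) le(2,1)]
      by (intro divide_right_mono) (simp_all add: dist_commute[of B A] dist_commute[of C A] mult.commute add.commute)
  qed (rule law_of_cosines_quotient_bounds)+
  ultimately show "greatest_central_angle A B C = angle_at A C B"
    by (simp add: greatest_central_angle_def)
  show "((dist A C)\<^sup>2 + (dist B C)\<^sup>2 - (dist A B)\<^sup>2) / (dist A C * dist B C) / 2 \<le> 1 / 2"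
    using cosine_opposite_longest_side(2)[OF pos le] by (rule divide_right_mono) simp
qed

text \<open>The triangle lies in the plane of height \<open>h\<close> with circumradius \<open>r = sqrt y\<close>. An inscribed angle is
half of the angle at the circumcentre, so placing the base vertices at the directions
\<open>\<plusminus> (pi - arccos c)\<close> from the apex gives the apex angle \<open>arccos c\<close>. This is
the greatest angle exactly because it is at least \<open>pi / 3\<close>.\<close>

lemma isosceles_inscribed_triangle:
  fixes c s y :: real
  assumes s: "0 < s" "s\<^sup>2 + c\<^sup>2 = 1" and c: "c \<le> 1 / 2" and y: "0 < y" "y \<le> 1"
  obtains A B C :: "real^3" where "inscribed_triangle A B C" "isosceles A B C"
    "greatest_central_angle A B C = arccos c"
    "\<bar>A \<bullet> cross3 B C\<bar> = 2 * y * (1 + c) * s * sqrt (1 - y)"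
    "1 + A \<bullet> B + B \<bullet> C + C \<bullet> A = 4 - 4 * y * s\<^sup>2 - c * (2 * y * (1 + c))"
proof -
  define r h where "r = sqrt y" and "h = sqrt (1 - y)"
  have r: "r > 0" "r * r = y" and h: "h \<ge> 0" "h * h = 1 - y"
    using y by (simp_all add: r_def h_def)
  have s2: "s * s = 1 - c * c"
    using s by (simp add: power2_eq_square)
  have "c\<^sup>2 < 1"
    using s zero_less_power[OF s(1), of 2] by linarith
  then have c1: "-1 < c"
    by (auto simp: abs_square_less_1)
  define A B C :: "real^3" where "A = vector [- r * c, r * s, h]" and "B = vector [- r * c, - r * s, h]"
    and "C = vector [r, 0, h]"
  note coords = A_def B_def C_def inner_vec_def sum_3 vector_3
  have ys: "r * (r * t) = y * t" "h * (h * t) = (1 - y) * t" "s * (s * t) = (1 - c * c) * t" for t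
    using r h s2 by (simp_all flip: mult.assoc)
  have unit: "A \<bullet> A = 1" "B \<bullet> B = 1" "C \<bullet> C = 1"
    by (simp_all add: coords algebra_simps ys r h s2)
  have inner: "A \<bullet> B = 1 - 2 * y * s\<^sup>2" "B \<bullet> C = 1 - y * (1 + c)" "C \<bullet> A = 1 - y * (1 + c)"
    by (simp_all add: coords algebra_simps ys r h s2 power2_eq_square)
  have w: "1 + A \<bullet> B + B \<bullet> C + C \<bullet> A = 4 - 4 * y * s\<^sup>2 - c * (2 * y * (1 + c))"
    unfolding inner by (simp add: power2_eq_square s2 algebra_simps)
  have "A \<bullet> cross3 B C = 2 * y * (1 + c) * s * h"
    by (simp add: coords cross3_def algebra_simps ys r h s2)
  then have D: "\<bar>A \<bullet> cross3 B C\<bar> = 2 * y * (1 + c) * s * sqrt (1 - y)"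
    using y c1 s h by (simp add: h_def abs_mult)
  have "\<not> collinear {A, C, B}"
  proof
    assume "collinear {A, C, B}"
    then consider "A = B" | u where "C = u *\<^sub>R A + (1 - u) *\<^sub>R B"
      unfolding collinear_3_expand by blast
    then show False
    proof cases
      case 1
      then show False
        using r s by (simp add: A_def B_def vec_eq_iff forall_3)
    next
      case 2
      then have "C $ 1 = (u *\<^sub>R A + (1 - u) *\<^sub>R B) $ 1"
        by simp
      then have "r * (1 + c) = 0"
        by (simp add: A_def B_def C_def algebra_simps)
      then show False
        using r c1 by simp
    qed
  qed
  then have inscribed: "inscribed_triangle A B C"
    using unit by (simp add: inscribed_triangle_def insert_commute norm_eq_sqrt_inner)
  have dist_sq: "(dist P Q)\<^sup>2 = 2 * (1 - P \<bullet> Q)" if "P \<bullet> P = 1" "Q \<bullet> Q = 1" for P Q :: "real^3"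
    using that by (simp add: dist_norm power2_norm_eq_inner inner_diff_left inner_diff_right inner_commute)
  have AB: "(dist A B)\<^sup>2 = 4 * y * s\<^sup>2" and AC: "(dist A C)\<^sup>2 = 2 * y * (1 + c)" and BC: "(dist B C)\<^sup>2 = 2 * y * (1 + c)"
    using inner by (simp_all add: dist_sq unit inner_commute)
  have eq: "dist A C = dist B C"
    using AC BC by (metis power2_eq_iff_nonneg zero_le_dist)
  have "2 * y * (1 + c) * 1 \<le> 2 * y * (1 + c) * (2 * (1 - c))"
    using y c1 c by (intro mult_left_mono) auto
  then have "(dist A C)\<^sup>2 \<le> (dist A B)\<^sup>2"
    unfolding AB AC by (simp add: power2_eq_square s2 algebra_simps)
  then have le: "dist A C \<le> dist A B"
    by (simp add: power2_le_iff_abs_le)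
  have "dist A C \<noteq> 0"
    using AC y c1 by auto
  then have ne: "A \<noteq> C" "B \<noteq> C"
    using eq by auto
  have "greatest_central_angle A B C = angle_at A C B"
    using greatest_central_angle_opposite_longest_edge(1)[OF ne] le eq by simp
  also have "\<dots> = arccos c"
  proof -
    have "((dist A C)\<^sup>2 + (dist B C)\<^sup>2 - (dist A B)\<^sup>2) / (dist A C * dist B C) / 2
        = (4 * y * (1 + c) - 4 * y * s\<^sup>2) / (2 * y * (1 + c)) / 2"
      using eq AB AC BC by (simp add: power2_eq_square)
    also have "4 * y * (1 + c) - 4 * y * s\<^sup>2 = c * (2 * (2 * y * (1 + c)))"
      by (simp add: power2_eq_square s2 algebra_simps)
    also have "\<dots> / (2 * y * (1 + c)) / 2 = c"
      using y c1 by simp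
    finally show ?thesis
      by (simp add: angle_at_sides)
  qed
  finally show ?thesis
    using that inscribed D w eq by (simp add: isosceles_def dist_commute)
qed

text \<open>Here \<open>c\<close> and \<open>s\<close> are cosine and sine of the angle at \<open>C\<close>, \<open>q\<close> is the product of the sides
meeting in \<open>C\<close>, and \<open>x = (dist A B / (2 * s))\<^sup>2\<close> is the squared circumradius by the law of sines.
The bound on \<open>q\<close> is the inequality between the arithmetic and geometric means of the squares of
these two sides, so it is sharp for isosceles triangles with apex \<open>C\<close>. The bound \<open>x \<le> 1\<close> holds
because a plane section of the unit sphere has radius at most \<open>1\<close>; algebraically, \<open>1 - x\<close> has the
sign of the square of the triple product.\<close>

lemma inscribed_triangle_parameters:
  fixes A B C :: "real^3"
  assumes ABC: "inscribed_triangle A B C"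
  obtains c s x q where "0 < s" "s\<^sup>2 + c\<^sup>2 = 1" "0 < x" "x \<le> 1" "0 < q" "q \<le> 2 * x * (1 + c)"
    "c = ((dist A C)\<^sup>2 + (dist B C)\<^sup>2 - (dist A B)\<^sup>2) / (dist A C * dist B C) / 2"
    "\<bar>A \<bullet> cross3 B C\<bar> = q * s * sqrt (1 - x)"
    "1 + A \<bullet> B + B \<bullet> C + C \<bullet> A = 4 - 4 * x * s\<^sup>2 - c * q"
proof -
  have unit: "A \<bullet> A = 1" "B \<bullet> B = 1" "C \<bullet> C = 1"
    using ABC by (auto simp: inscribed_triangle_def dot_square_norm)
  have nc: "\<not> collinear {A, C, B}"
    using ABC by (simp add: inscribed_triangle_def insert_commute)
  define n where "n = cross3 (A - C) (B - C)"
  have "n \<noteq> 0"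
    using nc by (metis collinear_3 cross_eq_0 n_def NO_MATCH_def)
  then have ne: "dist A C > 0" "dist B C > 0"
    by (auto simp: n_def)
  have "A \<noteq> B"
    using \<open>n \<noteq> 0\<close> by (auto simp: n_def)
  define q where "q = dist A C * dist B C"
  define c where "c = ((dist A C)\<^sup>2 + (dist B C)\<^sup>2 - (dist A B)\<^sup>2) / (dist A C * dist B C) / 2"
  define s where "s = norm n / q"
  define N where "N = (dist A B)\<^sup>2"
  define x where "x = N / (4 * s\<^sup>2)"
  have q: "q > 0"
    using ne by (simp add: q_def)
  have s: "s > 0"
    using q \<open>n \<noteq> 0\<close> by (simp add: s_def)
  have N: "N > 0"
    using \<open>A \<noteq> B\<close> by (simp add: N_def)
  have x: "x > 0"
    using N s by (simp add: x_def)
  have xN: "4 * x * s\<^sup>2 = N"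
    using s by (simp add: x_def)
  have cq: "2 * (c * q) = (dist A C)\<^sup>2 + (dist B C)\<^sup>2 - N"
    using q unfolding c_def q_def[symmetric] N_def[symmetric] by simp
  have "(norm n)\<^sup>2 + (c * q)\<^sup>2 = q\<^sup>2"
  proof -
    have "(A - C) \<bullet> (B - C) = c * q"
      using law_of_cosines[of A C B] cq by (simp add: N_def)
    then show ?thesis
      using norm_cross_dot[of "A - C" "B - C"] by (simp add: n_def q_def dist_norm)
  qed
  then have "q\<^sup>2 * (s\<^sup>2 + c\<^sup>2) = q\<^sup>2 * 1"
    using q by (simp add: s_def power_divide power_mult_distrib algebra_simps)
  then have sc: "s\<^sup>2 + c\<^sup>2 = 1"
    using q by simp
  have "c\<^sup>2 < 1"
    using s sc zero_less_power[of s 2] by linarith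
  then have c1: "-1 < c" "c < 1"
    by (auto simp: abs_square_less_1)
  have dist_sq: "P \<bullet> Q = 1 - (dist P Q)\<^sup>2 / 2" if "P \<bullet> P = 1" "Q \<bullet> Q = 1" for P Q :: "real^3"
    using that by (simp add: dist_norm power2_norm_eq_inner inner_diff_left inner_diff_right inner_commute diff_divide_distrib)
  have w: "1 + A \<bullet> B + B \<bullet> C + C \<bullet> A = 4 - 4 * x * s\<^sup>2 - c * q"
    unfolding xN using cq by (simp add: dist_sq unit N_def dist_commute)
  have Dsq: "(A \<bullet> cross3 B C)\<^sup>2 = (q * s)\<^sup>2 * (1 - x)"
  proof -
    define u v where "u = (dist A C)\<^sup>2" and "v = (dist B C)\<^sup>2"
    have "4 * (A \<bullet> cross3 B C)\<^sup>2 = 4 * u * v - (u + v - N)\<^sup>2 - u * v * N"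
      unfolding triple_product_square unit
      by (simp add: dist_sq unit dist_commute N_def u_def v_def power2_eq_square field_simps)
    also have "u * v = q\<^sup>2"
      by (simp add: u_def v_def q_def power_mult_distrib)
    also have "u + v - N = 2 * (c * q)"
      using cq by (simp add: u_def v_def)
    finally have "4 * (A \<bullet> cross3 B C)\<^sup>2 = 4 * q\<^sup>2 * (1 - c\<^sup>2) - q\<^sup>2 * N"
      using \<open>u * v = q\<^sup>2\<close> by (simp add: power2_eq_square algebra_simps)
    also have "1 - c\<^sup>2 = s\<^sup>2"
      using sc by simp
    finally show ?thesis
      unfolding xN[symmetric] by (simp add: power_mult_distrib algebra_simps)
  qed
  then have "(q * s)\<^sup>2 * (1 - x) \<ge> 0"
    by (metis zero_le_power2)
  then have "x \<le> 1"
    using q s by (simp add: zero_le_mult_iff)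
  have D: "\<bar>A \<bullet> cross3 B C\<bar> = q * s * sqrt (1 - x)"
    using arg_cong[OF Dsq, of sqrt] q s by (simp add: real_sqrt_mult)
  have "q \<le> 2 * x * (1 + c)"
  proof -
    have "0 \<le> (dist A C - dist B C)\<^sup>2"
      by simp
    then have "2 * q \<le> N + 2 * (c * q)"
      unfolding cq by (simp add: q_def power2_eq_square algebra_simps)
    then have "2 * (1 - c) * q \<le> 4 * x * s\<^sup>2"
      unfolding xN by (simp add: algebra_simps)
    also have "s\<^sup>2 = (1 - c) * (1 + c)"
      using sc by (simp add: power2_eq_square algebra_simps)
    also have "4 * x * ((1 - c) * (1 + c)) = 2 * (1 - c) * (2 * x * (1 + c))"
      by algebra
    finally have "2 * (1 - c) * q \<le> 2 * (1 - c) * (2 * x * (1 + c))" .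
    then show ?thesis
      using c1 by simp
  qed
  then show ?thesis
    using that[of s c x q] s sc x \<open>x \<le> 1\<close> q D w c_def by blast
qed

text \<open>If the centre lies in the plane \<open>ABC\<close> (\<open>x = 1\<close>), then area and volume vanish, and so they do for an
isosceles triangle inscribed in a great circle. Otherwise the matching parameter yields a
triangle whose \<open>w + \<i> D\<close> is a positive multiple of the original one, so that \<open>Arg\<close> and the area are
preserved, and whose \<open>D\<close>, to which the volume is proportional, is not smaller.\<close>

lemma isosceles_comparison_if_AB_longest:
  fixes A B C :: "real^3"
  assumes ABC: "inscribed_triangle A B C" and le: "dist A C \<le> dist A B" "dist B C \<le> dist A B"
  shows "\<exists>A' B' C' :: real^3.
    inscribed_triangle A' B' C' \<and> isosceles A' B' C' \<and>
    greatest_central_angle A' B' C' = greatest_central_angle A B C \<and>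
    spherical_area A' B' C' = spherical_area A B C \<and>
    measure lebesgue (facial_tetrahedron A' B' C') \<ge> measure lebesgue (facial_tetrahedron A B C)"
proof -
  obtain c s x q where sc: "0 < s" "s\<^sup>2 + c\<^sup>2 = 1" and x: "0 < x" "x \<le> 1" and q: "0 < q" "q \<le> 2 * x * (1 + c)"
    and c: "c = ((dist A C)\<^sup>2 + (dist B C)\<^sup>2 - (dist A B)\<^sup>2) / (dist A C * dist B C) / 2"
    and D: "\<bar>A \<bullet> cross3 B C\<bar> = q * s * sqrt (1 - x)"
    and w: "1 + A \<bullet> B + B \<bullet> C + C \<bullet> A = 4 - 4 * x * s\<^sup>2 - c * q"
    by (rule inscribed_triangle_parameters[OF ABC])
  have nc: "\<not> collinear {A, B, C}" and unit: "norm A = 1" "norm B = 1" "norm C = 1"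
    using ABC by (auto simp: inscribed_triangle_def)
  have ne: "A \<noteq> C" "B \<noteq> C"
    using nc by (auto simp: insert_commute)
  have angle: "greatest_central_angle A B C = arccos c" and c2: "c \<le> 1 / 2"
    using greatest_central_angle_opposite_longest_edge[OF ne le] by (simp_all add: c angle_at_sides)
  show ?thesis
  proof (cases "x = 1")
    case True
    obtain A' B' C' :: "real^3" where T: "inscribed_triangle A' B' C'" "isosceles A' B' C'"
      "greatest_central_angle A' B' C' = arccos c" "\<bar>A' \<bullet> cross3 B' C'\<bar> = 2 * 1 * (1 + c) * s * sqrt (1 - 1)"
      using isosceles_inscribed_triangle[OF sc c2 zero_less_one order_refl] by metis
    then have "A' \<bullet> cross3 B' C' = 0"
      by simp
    moreover have "A \<bullet> cross3 B C = 0"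
      using D True by simp
    ultimately show ?thesis
      using T angle nc unfolding inscribed_triangle_def
      by (metis spherical_area_coplanar measure_facial_tetrahedron abs_zero mult_zero_left order_refl)
  next
    case False
    with x have "x < 1" by simp
    obtain y where y: "0 < y" "y < 1"
      and same: "2 * y * (1 + c) * s * sqrt (1 - y) * (4 - 4 * x * s\<^sup>2 - c * q)
        = q * s * sqrt (1 - x) * (4 - 4 * y * s\<^sup>2 - c * (2 * y * (1 + c)))"
      and ge: "q * s * sqrt (1 - x) \<le> 2 * y * (1 + c) * s * sqrt (1 - y)"
      using isosceles_parameter_exists[OF sc x(1) \<open>x < 1\<close> q] .
    obtain A' B' C' :: "real^3" where T: "inscribed_triangle A' B' C'" "isosceles A' B' C'"
      "greatest_central_angle A' B' C' = arccos c"
      and D': "\<bar>A' \<bullet> cross3 B' C'\<bar> = 2 * y * (1 + c) * s * sqrt (1 - y)"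
      and w': "1 + A' \<bullet> B' + B' \<bullet> C' + C' \<bullet> A' = 4 - 4 * y * s\<^sup>2 - c * (2 * y * (1 + c))"
      using isosceles_inscribed_triangle[OF sc c2 y(1) less_imp_le[OF y(2)]] by blast
    define d d' v v' where "d = \<bar>A \<bullet> cross3 B C\<bar>" and "d' = \<bar>A' \<bullet> cross3 B' C'\<bar>"
      and "v = 1 + A \<bullet> B + B \<bullet> C + C \<bullet> A" and "v' = 1 + A' \<bullet> B' + B' \<bullet> C' + C' \<bullet> A'"
    have d: "0 < d" "d \<le> d'" "d' * v = d * v'"
      using q sc \<open>x < 1\<close> ge same by (simp_all add: d_def d'_def v_def v'_def D D' w w')
    have "Complex v' d' = of_real (d' / d) * Complex v d"
      using d by (simp add: complex_eq_iff field_simps)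
    then have "Arg (Complex v' d') = Arg (Complex v d)"
      using d by (simp only: Arg_times_of_real) (simp add: Arg_times_of_real)
    moreover have "spherical_area A B C = 2 * Arg (Complex v d)"
      unfolding v_def d_def using d(1) unit by (intro spherical_area_eq_Arg) (auto simp: d_def)
    moreover have "spherical_area A' B' C' = 2 * Arg (Complex v' d')"
      unfolding v'_def d'_def using d T(1)
      by (intro spherical_area_eq_Arg) (auto simp: d'_def inscribed_triangle_def)
    ultimately have "spherical_area A' B' C' = spherical_area A B C"
      by simp
    moreover have "measure lebesgue (facial_tetrahedron A B C) \<le> measure lebesgue (facial_tetrahedron A' B' C')"
      unfolding measure_facial_tetrahedron[of A B C] measure_facial_tetrahedron[of A' B' C']
      using d(2) by (intro mult_right_mono) (simp_all add: d_def d'_def)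
    ultimately show ?thesis
      using T angle by metis
  qed
qed

lemma vertex_symmetry:
  shows greatest_central_angle_swap: "greatest_central_angle A C B = greatest_central_angle A B C"
    and greatest_central_angle_rotate: "greatest_central_angle B C A = greatest_central_angle A B C"
    and spherical_area_swap: "spherical_area A C B = spherical_area A B C"
    and spherical_area_rotate: "spherical_area B C A = spherical_area A B C"
    and facial_tetrahedron_swap: "facial_tetrahedron A C B = facial_tetrahedron A B C"
    and facial_tetrahedron_rotate: "facial_tetrahedron B C A = facial_tetrahedron A B C"
    and inscribed_triangle_swap: "inscribed_triangle A C B = inscribed_triangle A B C"
    and inscribed_triangle_rotate: "inscribed_triangle B C A = inscribed_triangle A B C"
proof -
  have "{angle_at C A B, angle_at A C B, angle_at A B C} = {angle_at B A C, angle_at A B C, angle_at A C B}"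
    "{angle_at C B A, angle_at B C A, angle_at B A C} = {angle_at B A C, angle_at A B C, angle_at A C B}"
    unfolding angle_at_commute[of C A B] angle_at_commute[of C B A] angle_at_commute[of B C A] by auto
  then show "greatest_central_angle A C B = greatest_central_angle A B C"
    and "greatest_central_angle B C A = greatest_central_angle A B C"
    by (simp_all only: greatest_central_angle_def)
  have "{A, C, B} = {A, B, C}" "{B, C, A} = {A, B, C}"
    "{A, C, B, 0} = {A, B, C, 0}" "{B, C, A, 0} = {A, B, C, 0}"
    by auto
  then show "spherical_area A C B = spherical_area A B C" "spherical_area B C A = spherical_area A B C"
    "facial_tetrahedron A C B = facial_tetrahedron A B C" "facial_tetrahedron B C A = facial_tetrahedron A B C"
    "inscribed_triangle A C B = inscribed_triangle A B C" "inscribed_triangle B C A = inscribed_triangle A B C"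
    by (simp_all only: spherical_area_def spherical_triangle_def facial_tetrahedron_def inscribed_triangle_def)
qed

theorem proposition2:
  fixes A B C :: "real^3"
  assumes "inscribed_triangle A B C"
  shows "\<exists>A' B' C' :: real^3.
    inscribed_triangle A' B' C' \<and> isosceles A' B' C' \<and>
    greatest_central_angle A' B' C' = greatest_central_angle A B C \<and>
    spherical_area A' B' C' = spherical_area A B C \<and>
    measure lebesgue (facial_tetrahedron A' B' C') \<ge> measure lebesgue (facial_tetrahedron A B C)"
proof -
  consider "dist A C \<le> dist A B" "dist B C \<le> dist A B" | "dist A B \<le> dist A C" "dist C B \<le> dist A C"
    | "dist B A \<le> dist B C" "dist C A \<le> dist B C"
    unfolding dist_commute[of C B] dist_commute[of B A] dist_commute[of C A] by linarith
  then show ?thesis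
  proof cases
    case 1
    then show ?thesis
      by (rule isosceles_comparison_if_AB_longest[OF assms])
  next
    case 2
    then show ?thesis
      using isosceles_comparison_if_AB_longest[of A C B] assms
      by (simp only: greatest_central_angle_swap[of A C B] spherical_area_swap[of A C B]
          facial_tetrahedron_swap[of A C B] inscribed_triangle_swap[of A C B])
  next
    case 3
    then show ?thesis
      using isosceles_comparison_if_AB_longest[of B C A] assms
      by (simp only: greatest_central_angle_rotate[of B C A] spherical_area_rotate[of B C A]
          facial_tetrahedron_rotate[of B C A] inscribed_triangle_rotate[of B C A])
  qed
qed

end
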